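(* Let $n\ge 1$ and $1\le k\le n^2$ be integers and let $K$ be any field. Let $R=K[x_{11},\dots,x_{nn},y_{11},\dots,y_{nn}]$ be the polynomial ring in the $2n^2$ variables $x_{ij},y_{ij}$ ($1\le i,j\le n$), with the $\mathbb{N}^2$-grading in which every $x_{ij}$ has degree $(1,0)$ and every $y_{ij}$ has degree $(0,1)$. Let $I\subset R$ be the ideal generated by the squares of all the variables together with $$\{x_{ij}y_{lm}\mid \text{a queen can move from square }(i,j)\text{ to square }(l,m)\}.$$ Define $$\mu(k)=\max\{\mu\in\mathbb{N}\mid \dim_K (R/I)_{(k,\mu)}>0\}.$$ Then $\mu(k)$ is the maximal number of squares of the $n\times n$ chessboard which can remain unattacked after placing $k$ queens on it.
   Context: The squares of the $n\times n$ chessboard are identified with the pairs $(i,j)$, $1\le i,j\le n$. A queen can move from $(i,j)$ to $(l,m)$ if and only if $(i,j)\ne(l,m)$ and the two squares lie in the same row ($i=l$), the same column ($j=m$), or the same diagonal ($|i-l|=|j-m|$). Placing $k$ queens on the board means choosing a set of $k$ distinct squares (queens are indistinguishable). A square $(l,m)$ of the board is unattacked by such a placement if no placed queen, located at $(i,j)$ say, can move from $(i,j)$ to $(l,m)$, that is, if no placed queen is located at a square $(i,j)\ne(l,m)$ with $i=l$, $j=m$ or $|i-l|=|j-m|$. (In particular, an occupied square is unattacked if none of the other queens can move to it. Blocking by other queens is irrelevant: a square is attacked by some queen with blocking taken into account if and only if it is attacked by some queen without.) $\mathbb{N}$ includes $0$. Since $I$ is a monomial ideal, $R/I$ inherits the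 $\mathbb{N}^2$-grading, and $(R/I)_{(a,b)}$ denotes its homogeneous component of degree $(a,b)$, a finite-dimensional $K$-vector space. *)

theory Defs
  imports "HOL-Library.Poly_Mapping" "HOL-Algebra.QuotRing" "HOL-Algebra.Embedded_Algebras"
begin

section \<open>Queens on the chessboard\<close>

type_synonym square = "nat \<times> nat"

definition board :: "nat \<Rightarrow> square set" where
  "board n = {1..n} \<times> {1..n}"

fun queen_move :: "square \<Rightarrow> square \<Rightarrow> bool" where
  "queen_move (i, j) (l, m) \<longleftrightarrow>
     (i, j) \<noteq> (l, m) \<and> (i = l \<or> j = m \<or> \<bar>int i - int l\<bar> = \<bar>int j - int m\<bar>)"

text \<open>The unattacked squares may include squares occupied by queens.\<close>

definition unattacked :: "nat \<Rightarrow> square set \<Rightarrow> square set" where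
  "unattacked n Q = {t \<in> board n. \<not> (\<exists>s\<in>Q. queen_move s t)}"

definition max_unattacked :: "nat \<Rightarrow> nat \<Rightarrow> nat" where
  "max_unattacked n k = Max {card (unattacked n Q) | Q. Q \<subseteq> board n \<and> card Q = k}"


section \<open>The polynomial ring\<close>

text \<open>
  A polynomial is a finitely supported function from monomials to coefficients, and a monomial
  is a finitely supported function from variables to exponents. The type \<open>'k qpoly\<close> has
  the variables \<open>XV (i, j)\<close> and \<open>YV (i, j)\<close> for all natural numbers \<open>i\<close> and \<open>j\<close>;
  the carrier of \<open>qring n\<close> cuts it down to the polynomials in the \<open>2 * n^2\<close> variables that
  belong to squares of the board.
\<close>

datatype qvar = XV square | YV square

type_synonym qmonom = "qvar \<Rightarrow>\<^sub>0 nat"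

type_synonym 'k qpoly = "qmonom \<Rightarrow>\<^sub>0 'k"

definition qvars :: "nat \<Rightarrow> qvar set" where
  "qvars n = XV ` board n \<union> YV ` board n"

definition qring :: "nat \<Rightarrow> 'k::field qpoly ring" where
  "qring n = \<lparr>carrier = {p. \<forall>m \<in> Poly_Mapping.keys p. Poly_Mapping.keys m \<subseteq> qvars n},
     monoid.mult = (*), one = 1, ring.zero = 0, add = (+)\<rparr>"

definition pvar :: "qvar \<Rightarrow> 'k::field qpoly" where
  "pvar v = Poly_Mapping.single (Poly_Mapping.single v 1) 1"

definition pconst :: "'k::field \<Rightarrow> 'k qpoly" where
  "pconst c = Poly_Mapping.single 0 c"

definition xdeg :: "qmonom \<Rightarrow> nat" where
  "xdeg m = (\<Sum>s | XV s \<in> Poly_Mapping.keys m. Poly_Mapping.lookup m (XV s))"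

definition ydeg :: "qmonom \<Rightarrow> nat" where
  "ydeg m = (\<Sum>s | YV s \<in> Poly_Mapping.keys m. Poly_Mapping.lookup m (YV s))"

definition qring_component :: "nat \<Rightarrow> nat \<Rightarrow> nat \<Rightarrow> 'k::field qpoly set" where
  "qring_component n a b =
     {p \<in> carrier (qring n). \<forall>m \<in> Poly_Mapping.keys p. xdeg m = a \<and> ydeg m = b}"


section \<open>The ideal and the bigraded quotient\<close>

definition queens_ideal :: "nat \<Rightarrow> 'k::field qpoly set" where
  "queens_ideal n = Idl\<^bsub>qring n\<^esub>
     ({(pvar v)\<^sup>2 | v. v \<in> qvars n} \<union>
      {pvar (XV s) * pvar (YV t) | s t. s \<in> board n \<and> t \<in> board n \<and> queen_move s t})"

definition quot_ring :: "nat \<Rightarrow> 'k::field qpoly set ring" where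
  "quot_ring n = qring n Quot queens_ideal n"

definition residue_class :: "nat \<Rightarrow> 'k::field qpoly \<Rightarrow> 'k qpoly set" where
  "residue_class n p = queens_ideal n +>\<^bsub>qring n\<^esub> p"

text \<open>
  The dimension over a subfield of a ring is taken with respect to the multiplication of that
  ring, so the coefficient field enters as the image of the constant polynomials.
\<close>

definition quot_scalars :: "'k::field itself \<Rightarrow> nat \<Rightarrow> 'k qpoly set set" where
  "quot_scalars _ n = range (\<lambda>c. residue_class n (pconst c))"

definition quot_component :: "'k::field itself \<Rightarrow> nat \<Rightarrow> nat \<Rightarrow> nat \<Rightarrow> 'k qpoly set set" where
  "quot_component _ n a b = residue_class n ` qring_component n a b"

definition quot_dim :: "'k::field itself \<Rightarrow> nat \<Rightarrow> nat \<Rightarrow> nat \<Rightarrow> nat" where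
  "quot_dim K n a b = ring.dim (quot_ring n) (quot_scalars K n) (quot_component K n a b)"

definition mu :: "'k::field itself \<Rightarrow> nat \<Rightarrow> nat \<Rightarrow> nat" where
  "mu K n k = Max {\<mu>. quot_dim K n k \<mu> > 0}"

end

theory Submission
  imports Defs
begin

text \<open>
  The ideal \<open>I\<close> is generated by monomials, so a polynomial lies in \<open>I\<close> exactly when each of
  its monomials is divisible by a generator (\<open>queens_ideal_eq\<close>). Hence \<open>(R/I)\<^bsub>(a,b)\<^esub>\<close> is
  nonzero exactly when some monomial of bidegree \<open>(a, b)\<close> is divisible by no generator. Such a
  monomial is squarefree because the squares of the variables are generators, so it is a product
  of \<open>x\<^sub>s\<close> over a set \<open>Q\<close> of \<open>a\<close> squares and of \<open>y\<^sub>t\<close> over a set \<open>T\<close> of \<open>b\<close> squares; the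
  mixed generators forbid precisely that a queen on \<open>Q\<close> attacks a square of \<open>T\<close>
  (\<open>peaceful_monom_iff\<close>). For given \<open>Q\<close>, every cardinality up to that of the set of
  unattacked squares is attained by some \<open>T\<close>. The values \<open>\<mu>\<close> with a nonzero component are
  therefore the initial segment of the natural numbers up to the maximal number of unattacked
  squares.

  A dimension is positive exactly when the space is nonzero, but only if the dimension exists:
  it is a definite description, with no useful value for a space of infinite
  dimension. The components of \<open>R\<close> are spanned by the finitely many monomials of
  their bidegree (\<open>qring_component_eq_Span\<close>), and spans are preserved by the projection to the
  quotient, so the components of \<open>R/I\<close> are finite-dimensional (\<open>quot_component_finite_dim\<close>).
\<close>

section \<open>Polynomials and their terms\<close>

text \<open>
  A polynomial is the sum of its terms. Membership in the ideal and membership in a span both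
  reduce to single terms by this principle.
\<close>

lemma poly_mapping_in_if_terms_in:
  fixes p :: "'a \<Rightarrow>\<^sub>0 'b::comm_monoid_add"
  assumes "0 \<in> S" and "\<And>x y. x \<in> S \<Longrightarrow> y \<in> S \<Longrightarrow> x + y \<in> S"
    and "\<And>m. m \<in> Poly_Mapping.keys p \<Longrightarrow> Poly_Mapping.single m (Poly_Mapping.lookup p m) \<in> S"
  shows "p \<in> S"
proof -
  have "p = (\<Sum>m\<in>Poly_Mapping.keys p. Poly_Mapping.single m (Poly_Mapping.lookup p m))"
    by (rule poly_mapping_eqI)
      (auto simp: lookup_sum lookup_single when_def in_keys_iff)
  moreover have "(\<Sum>m\<in>A. Poly_Mapping.single m (Poly_Mapping.lookup p m)) \<in> S"
    if "finite A" "A \<subseteq> Poly_Mapping.keys p" for A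
    using that by (induction rule: finite_induct) (auto simp: assms)
  ultimately show ?thesis
    by (metis finite_keys order_refl)
qed

lemma keys_uminus: "Poly_Mapping.keys (- p) = Poly_Mapping.keys (p :: 'k::field qpoly)"
  by (auto simp: in_keys_iff)

lemma keys_add_nat:
  "Poly_Mapping.keys (a + b) = Poly_Mapping.keys a \<union> Poly_Mapping.keys (b :: 'a \<Rightarrow>\<^sub>0 nat)"
  by (auto simp: in_keys_iff lookup_add)

lemma qring_simps:
  "x \<in> carrier (qring n) \<longleftrightarrow> (\<forall>m\<in>Poly_Mapping.keys x. Poly_Mapping.keys m \<subseteq> qvars n)"
  "x \<otimes>\<^bsub>qring n\<^esub> y = x * y" "x \<oplus>\<^bsub>qring n\<^esub> y = x + y"
  "\<one>\<^bsub>qring n\<^esub> = 1" "\<zero>\<^bsub>qring n\<^esub> = 0"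
  by (simp_all add: qring_def)

lemma qring_mult_closed:
  assumes "p \<in> carrier (qring n)" "q \<in> carrier (qring n)"
  shows "p * q \<in> carrier (qring n)"
  unfolding qring_simps
proof
  fix m assume "m \<in> Poly_Mapping.keys (p * q)"
  with keys_mult[of p q] obtain a b
    where "m = a + b" "a \<in> Poly_Mapping.keys p" "b \<in> Poly_Mapping.keys q"
    by blast
  with assms show "Poly_Mapping.keys m \<subseteq> qvars n"
    by (auto simp: qring_simps keys_add_nat dest!: bspec)
qed

lemma qring_add_closed:
  assumes "p \<in> carrier (qring n)" "q \<in> carrier (qring n)"
  shows "p + q \<in> carrier (qring n)"
  using assms keys_add[of p q] by (auto simp: qring_simps)

lemma qring_uminus_closed: "p \<in> carrier (qring n) \<Longrightarrow> - p \<in> carrier (qring n)"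
  by (simp add: qring_simps keys_uminus)

lemma cring_qring: "cring (qring n :: 'k::field qpoly ring)"
proof (rule cringI)
  show "abelian_group (qring n :: 'k qpoly ring)"
  proof (rule abelian_groupI)
    fix x :: "'k qpoly" assume "x \<in> carrier (qring n)"
    then show "\<exists>y\<in>carrier (qring n). y \<oplus>\<^bsub>qring n\<^esub> x = \<zero>\<^bsub>qring n\<^esub>"
      by (intro bexI[of _ "- x"]) (simp_all add: qring_simps(2-) qring_uminus_closed)
  qed (simp_all add: qring_add_closed qring_simps(2-) add_ac, simp add: qring_simps)
  show "Group.comm_monoid (qring n :: 'k qpoly ring)"
    by (rule comm_monoidI)
      (simp_all add: qring_mult_closed qring_simps(2-) mult_ac, simp add: qring_simps)
qed (simp add: qring_simps(2-) distrib_right)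

lemma ring_qring: "ring (qring n :: 'k::field qpoly ring)"
  using cring_qring by (rule cring.axioms)

lemma qring_a_inv: "p \<in> carrier (qring n) \<Longrightarrow> \<ominus>\<^bsub>qring n\<^esub> p = - p"
  by (rule abelian_group.minus_equality[OF ring.is_abelian_group[OF ring_qring]])
    (simp_all add: qring_simps(2-) qring_uminus_closed)


section \<open>The queens ideal as a monomial ideal\<close>

text \<open>
  For monomials on the board, being peaceful means being divisible by no generator of the ideal;
  divisibility is spelled out on exponents so that no reference to the size of the board remains.
\<close>

definition peaceful :: "qmonom \<Rightarrow> bool" where
  "peaceful m \<longleftrightarrow> (\<forall>v. Poly_Mapping.lookup m v \<le> 1) \<and>
     (\<forall>s t. XV s \<in> Poly_Mapping.keys m \<longrightarrow> YV t \<in> Poly_Mapping.keys m \<longrightarrow> \<not> queen_move s t)"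

lemma peaceful_add_left: "peaceful (a + b) \<Longrightarrow> peaceful a"
  unfolding peaceful_def keys_add_nat lookup_add by (meson UnI1 add_leD1)

lemma not_peaceful_mult:
  fixes p q :: "'k::field qpoly"
  assumes "\<forall>m\<in>Poly_Mapping.keys p. \<not> peaceful m"
  shows "\<forall>m\<in>Poly_Mapping.keys (p * q). \<not> peaceful m"
  using assms keys_mult[of p q] peaceful_add_left by blast

lemma ideal_non_peaceful:
  "ideal {p \<in> carrier (qring n). \<forall>m\<in>Poly_Mapping.keys p. \<not> peaceful m}
     (qring n :: 'k::field qpoly ring)" (is "ideal ?J _")
proof (rule idealI[OF ring_qring])
  interpret cring "qring n :: 'k qpoly ring" by (rule cring_qring)
  show "subgroup ?J (add_monoid (qring n))"
  proof (rule add.subgroupI)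
    show "?J \<noteq> {}"
      by (auto simp: qring_simps intro!: exI[of _ 0])
    show "\<ominus>\<^bsub>qring n\<^esub> a \<in> ?J" if "a \<in> ?J" for a
      using that by (simp add: qring_a_inv qring_uminus_closed keys_uminus)
    show "a \<oplus>\<^bsub>qring n\<^esub> b \<in> ?J" if "a \<in> ?J" "b \<in> ?J" for a b
      using that keys_add[of a b] by (auto simp: qring_simps(2-) qring_add_closed)
  qed auto
  fix a x :: "'k qpoly" assume a: "a \<in> ?J" and x: "x \<in> carrier (qring n)"
  then show "a \<otimes>\<^bsub>qring n\<^esub> x \<in> ?J"
    using not_peaceful_mult[of a x] by (simp add: qring_simps(2-) qring_mult_closed)
  with a x show "x \<otimes>\<^bsub>qring n\<^esub> a \<in> ?J"
    by (simp add: m_comm)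
qed

definition queens_generators :: "nat \<Rightarrow> 'k::field qpoly set" where
  "queens_generators n = {(pvar v)\<^sup>2 | v. v \<in> qvars n} \<union>
      {pvar (XV s) * pvar (YV t) | s t. s \<in> board n \<and> t \<in> board n \<and> queen_move s t}"

lemma pvar_mult:
  "(pvar v * pvar w :: 'k::field qpoly) =
     Poly_Mapping.single (Poly_Mapping.single v 1 + Poly_Mapping.single w 1) 1"
  by (simp add: pvar_def mult_single)

lemma keys_pvar_mult:
  "Poly_Mapping.keys (pvar v * pvar w :: 'k::field qpoly) =
     {Poly_Mapping.single v 1 + Poly_Mapping.single w 1}"
  by (simp add: pvar_mult)

lemma queens_generators_non_peaceful:
  "queens_generators n \<subseteq>
     {p \<in> carrier (qring n :: 'k::field qpoly ring). \<forall>m\<in>Poly_Mapping.keys p. \<not> peaceful m}"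
proof -
  have "\<not> peaceful (Poly_Mapping.single v 1 + Poly_Mapping.single v 1)" for v
    by (auto simp: peaceful_def lookup_add intro!: exI[of _ v])
  moreover have "\<not> peaceful (Poly_Mapping.single (XV s) 1 + Poly_Mapping.single (YV t) 1)"
    if "queen_move s t" for s t
    using that by (auto simp: peaceful_def keys_add_nat)
  ultimately show ?thesis
    by (auto simp: queens_generators_def qring_simps power2_eq_square keys_pvar_mult
        keys_add_nat qvars_def)
qed

lemma queens_ideal_generated: "queens_ideal n = Idl\<^bsub>qring n\<^esub> (queens_generators n)"
  by (simp add: queens_ideal_def queens_generators_def)

lemma ideal_queens_ideal: "ideal (queens_ideal n) (qring n :: 'k::field qpoly ring)"
  unfolding queens_ideal_generated
  using queens_generators_non_peaceful by (intro ring.genideal_ideal[OF ring_qring]) blast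

text \<open>
  In a monomial that is not peaceful, the two variables that witness this (which coincide if an
  exponent exceeds \<open>1\<close>) multiply to a generator; splitting it off leaves a cofactor on the
  board.
\<close>

lemma non_peaceful_term_in_queens_ideal:
  assumes m: "Poly_Mapping.keys m \<subseteq> qvars n" and bad: "\<not> peaceful m"
  shows "Poly_Mapping.single m c \<in> (queens_ideal n :: 'k::field qpoly set)"
proof -
  interpret ideal "queens_ideal n" "qring n :: 'k qpoly ring" by (rule ideal_queens_ideal)
  obtain v w where gen: "pvar v * pvar w \<in> (queens_generators n :: 'k qpoly set)"
    and le: "\<And>u. Poly_Mapping.lookup (Poly_Mapping.single v 1 + Poly_Mapping.single w 1) u
              \<le> Poly_Mapping.lookup m u"
  proof (cases "\<exists>v. Poly_Mapping.lookup m v > 1")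
    case True
    then obtain v where v: "Poly_Mapping.lookup m v > 1" by blast
    then have "v \<in> qvars n"
      using m by (auto simp: in_keys_iff)
    with v show ?thesis
      by (intro that[of v v])
        (auto simp: queens_generators_def power2_eq_square lookup_add lookup_single when_def)
  next
    case False
    then obtain s t where st: "XV s \<in> Poly_Mapping.keys m" "YV t \<in> Poly_Mapping.keys m"
      "queen_move s t"
      using bad by (auto simp: peaceful_def not_less)
    then have "s \<in> board n" "t \<in> board n"
      using m by (auto simp: qvars_def)
    with st have "pvar (XV s) * pvar (YV t) \<in> (queens_generators n :: 'k qpoly set)"
      unfolding queens_generators_def by blast
    with st show ?thesis
      by (intro that[of "XV s" "YV t"])
        (auto simp: lookup_add lookup_single when_def in_keys_iff)
  qed
  define g where "g = Poly_Mapping.single v (1::nat) + Poly_Mapping.single w 1"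
  \<comment> \<open>Subtraction of exponents is truncated; the bound on the exponents of \<open>g\<close> makes it exact.\<close>
  have split: "m = (m - g) + g"
    using le by (intro poly_mapping_eqI) (simp add: lookup_add lookup_minus g_def)
  have "Poly_Mapping.single (m - g) c \<in> carrier (qring n :: 'k qpoly ring)"
  proof -
    have "Poly_Mapping.keys (m - g) \<subseteq> qvars n"
      using m by (subst (asm) split) (simp add: keys_add_nat)
    then show ?thesis by (simp add: qring_simps)
  qed
  moreover have "pvar v * pvar w \<in> (queens_ideal n :: 'k qpoly set)"
    unfolding queens_ideal_generated
    using gen queens_generators_non_peaceful genideal_self[of "queens_generators n"] by blast
  ultimately have "Poly_Mapping.single (m - g) c * (pvar v * pvar w) \<in> queens_ideal n"
    using I_l_closed by (simp add: qring_simps(2-))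
  then show ?thesis
    unfolding pvar_mult mult_single g_def[symmetric] using split by simp
qed

lemma queens_ideal_eq:
  "(queens_ideal n :: 'k::field qpoly set) =
     {p \<in> carrier (qring n). \<forall>m\<in>Poly_Mapping.keys p. \<not> peaceful m}"
proof
  show "queens_ideal n \<subseteq> {p \<in> carrier (qring n :: 'k qpoly ring).
      \<forall>m\<in>Poly_Mapping.keys p. \<not> peaceful m}"
    unfolding queens_ideal_generated
    by (rule ring.genideal_minimal[OF ring_qring ideal_non_peaceful
          queens_generators_non_peaceful])
  interpret ideal "queens_ideal n" "qring n :: 'k qpoly ring" by (rule ideal_queens_ideal)
  show "{p \<in> carrier (qring n). \<forall>m\<in>Poly_Mapping.keys p. \<not> peaceful m} \<subseteq>
      (queens_ideal n :: 'k qpoly set)"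
  proof safe
    fix p :: "'k qpoly"
    assume p: "p \<in> carrier (qring n)" "\<forall>m\<in>Poly_Mapping.keys p. \<not> peaceful m"
    show "p \<in> queens_ideal n"
    proof (rule poly_mapping_in_if_terms_in)
      show "0 \<in> (queens_ideal n :: 'k qpoly set)"
        using additive_subgroup.zero_closed[OF additive_subgroup_axioms] by (simp add: qring_simps(5))
      show "x + y \<in> queens_ideal n" if "x \<in> queens_ideal n" "y \<in> queens_ideal n"
        for x y :: "'k qpoly"
        using additive_subgroup.a_closed[OF additive_subgroup_axioms that] by (simp add: qring_simps(3))
    qed (use p in \<open>auto simp: qring_simps intro: non_peaceful_term_in_queens_ideal\<close>)
  qed
qed


section \<open>Finite dimension of the graded components\<close>

lemma pconst_mult: "pconst c * pconst d = pconst (c * d)"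
  by (simp add: pconst_def mult_single)

lemma pconst_simps: "pconst 0 = 0" "pconst 1 = 1"
  by (simp_all add: pconst_def)

lemma pconst_uminus: "- pconst c = pconst (- c)"
  by (simp add: pconst_def single_uminus)

lemma pconst_carrier: "pconst c \<in> carrier (qring n)"
  by (simp add: pconst_def qring_simps)

lemma subfield_constants: "subfield (range pconst) (qring n :: 'k::field qpoly ring)"
proof -
  interpret cring "qring n :: 'k qpoly ring" by (rule cring_qring)
  show ?thesis
  proof (rule subfieldI)
    have "subring (range pconst) (qring n :: 'k qpoly ring)"
    proof (rule subringI)
      show "\<one>\<^bsub>qring n\<^esub> \<in> (range pconst :: 'k qpoly set)"
        by (metis pconst_simps(2) qring_simps(4) rangeI)
      show "\<ominus>\<^bsub>qring n\<^esub> h \<in> range pconst" if "h \<in> range pconst" for h :: "'k qpoly"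
        using that qring_a_inv[OF pconst_carrier, of n] by (metis imageE pconst_uminus rangeI)
      show "h \<oplus>\<^bsub>qring n\<^esub> h' \<in> range pconst" if "h \<in> range pconst" "h' \<in> range pconst"
        for h h' :: "'k qpoly"
        using that by (auto simp: qring_simps(3)) (metis pconst_def rangeI single_add)
    qed (auto simp: pconst_carrier qring_simps(2-) pconst_mult)
    then show "subcring (range pconst) (qring n :: 'k qpoly ring)"
      by (rule subcringI) (auto simp: qring_simps pconst_mult mult.commute)
    have "\<exists>d. pconst d * pconst c = 1 \<and> pconst c * pconst d = (1 :: 'k qpoly)"
      if "pconst c \<noteq> (0 :: 'k qpoly)" for c
    proof -
      have "c \<noteq> 0"
        using that by (auto simp: pconst_simps)
      then show ?thesis
        by (intro exI[of _ "inverse c"]) (simp add: pconst_mult pconst_simps)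
    qed
    then show "Units (qring n \<lparr>carrier := range pconst\<rparr>) =
        range pconst - {\<zero>\<^bsub>qring n :: 'k qpoly ring\<^esub>}"
      by (auto simp: Units_def qring_simps(2-))
  qed
qed

definition board_monoms :: "nat \<Rightarrow> nat \<Rightarrow> nat \<Rightarrow> qmonom set" where
  "board_monoms n a b = {m. Poly_Mapping.keys m \<subseteq> qvars n \<and> xdeg m = a \<and> ydeg m = b}"

lemma qring_component_iff:
  "p \<in> qring_component n a b \<longleftrightarrow> Poly_Mapping.keys p \<subseteq> board_monoms n a b"
  by (auto simp: qring_component_def board_monoms_def qring_simps)

lemma zero_in_qring_component: "0 \<in> qring_component n a b"
  by (simp add: qring_component_iff)

lemma finite_X_keys: "finite {s. XV s \<in> Poly_Mapping.keys m}"
  using finite_vimageI[OF finite_keys[of m], of XV] by (simp add: vimage_def inj_def)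

lemma finite_Y_keys: "finite {s. YV s \<in> Poly_Mapping.keys m}"
  using finite_vimageI[OF finite_keys[of m], of YV] by (simp add: vimage_def inj_def)

text \<open>
  A fixed bidegree bounds every exponent, and there are finitely many variables; this is why each
  component has a finite spanning set.
\<close>

lemma exponent_le_bidegree: "Poly_Mapping.lookup m v \<le> xdeg m + ydeg m"
proof (cases "v \<in> Poly_Mapping.keys m")
  case True
  show ?thesis
  proof (cases v)
    case (XV s)
    then have "Poly_Mapping.lookup m v \<le> xdeg m"
      unfolding xdeg_def using True by (auto intro!: member_le_sum[of s] simp: finite_X_keys)
    then show ?thesis by simp
  next
    case (YV s)
    then have "Poly_Mapping.lookup m v \<le> ydeg m"
      unfolding ydeg_def using True by (auto intro!: member_le_sum[of s] simp: finite_Y_keys)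
    then show ?thesis by simp
  qed
qed (simp add: in_keys_iff)

lemma finite_board: "finite (board n)"
  by (simp add: board_def)

lemma finite_board_monoms: "finite (board_monoms n a b)"
proof (rule finite_imageD)
  have "finite (qvars n)"
    by (simp add: qvars_def finite_board)
  then have "finite {f. \<forall>v. (v \<in> qvars n \<longrightarrow> f v \<in> {..a + b}) \<and> (v \<notin> qvars n \<longrightarrow> f v = 0)}"
    by (rule finite_set_of_finite_funs) simp
  then show "finite (Poly_Mapping.lookup ` board_monoms n a b)"
  proof (rule rev_finite_subset, intro subsetI CollectI allI conjI impI)
    fix f v assume "f \<in> Poly_Mapping.lookup ` board_monoms n a b"
    then obtain m where f: "f = Poly_Mapping.lookup m" and m: "m \<in> board_monoms n a b"
      by blast
    show "f v \<in> {..a + b}"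
      using exponent_le_bidegree[of m v] m by (simp add: f board_monoms_def)
    show "f v = 0" if "v \<notin> qvars n"
      using m that by (auto simp: f board_monoms_def in_keys_iff)
  qed
  show "inj_on Poly_Mapping.lookup (board_monoms n a b)"
    by (simp add: inj_on_def)
qed

lemma subalgebra_qring_component:
  "subalgebra (range pconst) (qring_component n a b) (qring n :: 'k::field qpoly ring)"
proof -
  interpret cring "qring n :: 'k qpoly ring" by (rule cring_qring)
  show ?thesis
  proof (intro subalgebra.intro subalgebra_axioms.intro)
    have carr: "qring_component n a b \<subseteq> carrier (qring n :: 'k qpoly ring)"
      by (auto simp: qring_component_def)
    show "subgroup (qring_component n a b) (add_monoid (qring n :: 'k qpoly ring))"
    proof (rule add.subgroupI[OF carr])
      show "qring_component n a b \<noteq> ({} :: 'k qpoly set)"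
        using zero_in_qring_component by blast
      show "\<ominus>\<^bsub>qring n\<^esub> p \<in> qring_component n a b" if "p \<in> qring_component n a b"
        for p :: "'k qpoly"
        using that carr by (simp add: qring_a_inv subsetD qring_component_iff keys_uminus)
      show "p \<oplus>\<^bsub>qring n\<^esub> q \<in> qring_component n a b"
        if "p \<in> qring_component n a b" "q \<in> qring_component n a b" for p q :: "'k qpoly"
        using that keys_add[of p q] by (auto simp: qring_simps qring_component_iff)
    qed
    fix k v :: "'k qpoly" assume "k \<in> range pconst" "v \<in> qring_component n a b"
    then show "k \<otimes>\<^bsub>qring n\<^esub> v \<in> qring_component n a b"
      using keys_mult[of k v] by (fastforce simp: qring_simps qring_component_iff pconst_def
          split: if_splits)
  qed
qed

lemma qring_component_eq_Span:
  fixes n a b :: nat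
  obtains Us where "set Us \<subseteq> carrier (qring n :: 'k::field qpoly ring)"
    and "qring_component n a b = ring.Span (qring n) (range pconst) Us"
proof -
  interpret cring "qring n :: 'k qpoly ring" by (rule cring_qring)
  obtain ms where ms: "set ms = board_monoms n a b"
    using finite_list[OF finite_board_monoms] by blast
  define Us :: "'k qpoly list" where "Us = map (\<lambda>m. Poly_Mapping.single m 1) ms"
  have Us: "set Us \<subseteq> qring_component n a b"
    by (auto simp: Us_def ms qring_component_iff)
  then have carr: "set Us \<subseteq> carrier (qring n)"
    by (auto simp: qring_component_def)
  note span = Span_subgroup_props[OF subfield_constants carr]
  have "p \<in> Span (range pconst) Us" if p: "p \<in> qring_component n a b" for p
  proof (rule poly_mapping_in_if_terms_in)
    show "0 \<in> Span (range pconst) Us"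
      using span(2) by (simp only: qring_simps)
    show "x + y \<in> Span (range pconst) Us"
      if "x \<in> Span (range pconst) Us" "y \<in> Span (range pconst) Us" for x y
      using span(3)[OF that] by (simp only: qring_simps)
    fix m assume "m \<in> Poly_Mapping.keys p"
    with p have "Poly_Mapping.single m 1 \<in> set Us"
      by (auto simp: Us_def ms qring_component_iff)
    then have "Poly_Mapping.single m 1 \<in> Span (range pconst) Us"
      using Span_base_incl[OF subfield_constants carr] by blast
    then have "pconst (Poly_Mapping.lookup p m) \<otimes>\<^bsub>qring n\<^esub> Poly_Mapping.single m 1
        \<in> Span (range pconst) Us"
      by (intro Span_smult_closed[OF subfield_constants carr]) auto
    then show "Poly_Mapping.single m (Poly_Mapping.lookup p m) \<in> Span (range pconst) Us"
      by (simp only: qring_simps) (simp add: pconst_def mult_single del: Span.simps)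
  qed
  moreover have "Span (range pconst) Us \<subseteq> qring_component n a b"
    by (rule subalgebra_Span_incl[OF subfield_constants subalgebra_qring_component Us])
  ultimately show ?thesis
    using that[OF carr] by blast
qed

lemma residue_class_hom:
  "ring_hom_ring (qring n) (quot_ring n) (residue_class n :: 'k::field qpoly \<Rightarrow> _)"
proof -
  have "residue_class n = (+>\<^bsub>qring n\<^esub>) (queens_ideal n :: 'k qpoly set)"
    by (simp add: residue_class_def fun_eq_iff)
  then show ?thesis
    unfolding quot_ring_def using ideal.rcos_ring_hom_ring[OF ideal_queens_ideal] by metis
qed

lemma residue_class_eq_zero_iff:
  assumes "p \<in> carrier (qring n)"
  shows "residue_class n p = \<zero>\<^bsub>quot_ring n\<^esub> \<longleftrightarrow> p \<in> (queens_ideal n :: 'k::field qpoly set)"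
proof -
  interpret ideal "queens_ideal n" "qring n :: 'k qpoly ring" by (rule ideal_queens_ideal)
  show ?thesis
    using assms a_rcos_const rcos_const_imp_mem
    by (auto simp: residue_class_def quot_ring_def FactRing_def)
qed

text \<open>
  The monomial \<open>1\<close> is peaceful, so it survives in the quotient. This makes the projection
  injective on constants, and hence the scalars of the quotient a field.
\<close>

lemma quot_one_neq_zero:
  "\<one>\<^bsub>quot_ring n\<^esub> \<noteq> \<zero>\<^bsub>quot_ring n :: 'k::field qpoly set ring\<^esub>"
proof -
  interpret ring_hom_ring "qring n" "quot_ring n" "residue_class n :: 'k qpoly \<Rightarrow> _"
    by (rule residue_class_hom)
  have "peaceful 0"
    by (simp add: peaceful_def)
  then have "(1 :: 'k qpoly) \<notin> queens_ideal n"
    by (simp add: queens_ideal_eq)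
  then show ?thesis
    using residue_class_eq_zero_iff[of "1 :: 'k qpoly" n] R.one_closed hom_one
    by (simp add: qring_simps(4))
qed

lemma quot_scalars_eq: "quot_scalars TYPE('k::field) n = residue_class n ` range pconst"
  by (auto simp: quot_scalars_def)

lemma subfield_quot_scalars: "subfield (quot_scalars TYPE('k::field) n) (quot_ring n)"
  unfolding quot_scalars_eq
  by (rule ring_hom_ring.img_is_subfield(2)[OF residue_class_hom subfield_constants
        quot_one_neq_zero])

lemma quot_component_finite_dim:
  "ring.finite_dimension (quot_ring n) (quot_scalars TYPE('k::field) n)
     (quot_component TYPE('k) n a b)"
proof -
  interpret ring_hom_ring "qring n" "quot_ring n" "residue_class n :: 'k qpoly \<Rightarrow> _"
    by (rule residue_class_hom)
  obtain Us where Us: "set Us \<subseteq> carrier (qring n :: 'k qpoly ring)"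
    and comp: "qring_component n a b = R.Span (range pconst) Us"
    by (rule qring_component_eq_Span)
  have "quot_component TYPE('k) n a b =
      S.Span (quot_scalars TYPE('k) n) (map (residue_class n) Us)"
    unfolding quot_component_def quot_scalars_eq comp
    by (rule Span_hom[symmetric]) (use Us pconst_carrier in auto)
  moreover have "set (map (residue_class n) Us) \<subseteq> carrier (quot_ring n)"
    using Us by auto
  ultimately show ?thesis
    using S.Span_finite_dimension[OF subfield_quot_scalars] by metis
qed

lemma (in ring) dim_pos_iff:
  assumes K: "subfield K R" and fin: "finite_dimension K E"
  shows "dim K E > 0 \<longleftrightarrow> E \<noteq> {\<zero>}"
proof
  have d: "dimension (dim K E) K E"
    using finite_dimensionE[OF K fin] by (simp add: over_def)
  show "E \<noteq> {\<zero>}" if "dim K E > 0"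
    using dimI[OF K zero_dim] that by (auto simp: over_def)
  show "dim K E > 0" if "E \<noteq> {\<zero>}"
    using d dimension_zero that K by (cases "dim K E") auto
qed

text \<open>
  A residue class is zero if and only if no monomial of its representative is peaceful, so a single
  monomial is already a nonzero witness as soon as there is any.
\<close>

lemma quot_dim_pos_iff:
  "quot_dim TYPE('k::field) n a b > 0 \<longleftrightarrow> (\<exists>m\<in>board_monoms n a b. peaceful m)"
proof -
  interpret ring_hom_ring "qring n" "quot_ring n" "residue_class n :: 'k qpoly \<Rightarrow> _"
    by (rule residue_class_hom)
  have carr: "p \<in> carrier (qring n)" if "p \<in> qring_component n a b" for p :: "'k qpoly"
    using that by (simp add: qring_component_def)
  have "\<zero>\<^bsub>quot_ring n\<^esub> \<in> quot_component TYPE('k) n a b"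
    unfolding quot_component_def using hom_zero zero_in_qring_component by (metis image_eqI qring_simps(5))
  then have "quot_dim TYPE('k) n a b > 0 \<longleftrightarrow>
      (\<exists>p\<in>qring_component n a b. residue_class n (p :: 'k qpoly) \<noteq> \<zero>\<^bsub>quot_ring n\<^esub>)"
    unfolding quot_dim_def S.dim_pos_iff[OF subfield_quot_scalars quot_component_finite_dim]
    by (auto simp: quot_component_def)
  also have "\<dots> \<longleftrightarrow>
      (\<exists>p :: 'k qpoly \<in> qring_component n a b. \<exists>m\<in>Poly_Mapping.keys p. peaceful m)"
    using carr by (simp add: residue_class_eq_zero_iff queens_ideal_eq cong: bex_cong)
  also have "\<dots> \<longleftrightarrow> (\<exists>m\<in>board_monoms n a b. peaceful m)"
  proof
    assume "\<exists>m\<in>board_monoms n a b. peaceful m"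
    then obtain m where "m \<in> board_monoms n a b" "peaceful m" by blast
    then show "\<exists>p :: 'k qpoly \<in> qring_component n a b. \<exists>m\<in>Poly_Mapping.keys p. peaceful m"
      by (intro bexI[of _ "Poly_Mapping.single m 1"]) (auto simp: qring_component_iff)
  qed (use qring_component_iff in blast)
  finally show ?thesis .
qed


section \<open>Peaceful monomials and placements of queens\<close>

text \<open>
  Exponents in a peaceful monomial are \<open>0\<close> or \<open>1\<close>, so it is determined by the set \<open>Q\<close> of
  squares of its \<open>x\<close>-variables and the set \<open>T\<close> of squares of its \<open>y\<close>-variables, and the two
  degrees are the cardinalities of these sets. No move from \<open>Q\<close> to \<open>T\<close> is the same as
  \<open>T\<close> being unattacked. The sets may overlap, since an occupied square can be unattacked.
\<close>

lemma peaceful_monom_iff: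
  "(\<exists>m\<in>board_monoms n a b. peaceful m) \<longleftrightarrow>
     (\<exists>Q T. Q \<subseteq> board n \<and> card Q = a \<and> T \<subseteq> unattacked n Q \<and> card T = b)"
proof
  assume "\<exists>m\<in>board_monoms n a b. peaceful m"
  then obtain m where m: "Poly_Mapping.keys m \<subseteq> qvars n" "xdeg m = a" "ydeg m = b"
    and "peaceful m"
    by (auto simp: board_monoms_def)
  let ?Q = "{s. XV s \<in> Poly_Mapping.keys m}" and ?T = "{t. YV t \<in> Poly_Mapping.keys m}"
  have one: "Poly_Mapping.lookup m v = 1" if "v \<in> Poly_Mapping.keys m" for v
    using \<open>peaceful m\<close> that unfolding peaceful_def in_keys_iff
    by (metis One_nat_def le_Suc_eq le_zero_eq)
  have "xdeg m = card ?Q" "ydeg m = card ?T"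
    using one by (simp_all add: xdeg_def ydeg_def)
  moreover have "?Q \<subseteq> board n" "?T \<subseteq> unattacked n ?Q"
    using m \<open>peaceful m\<close>
    by (auto simp: qvars_def unattacked_def peaceful_def simp del: queen_move.simps)
  ultimately show
    "\<exists>Q T. Q \<subseteq> board n \<and> card Q = a \<and> T \<subseteq> unattacked n Q \<and> card T = b"
    using m by metis
next
  assume "\<exists>Q T. Q \<subseteq> board n \<and> card Q = a \<and> T \<subseteq> unattacked n Q \<and> card T = b"
  then obtain Q T where Q: "Q \<subseteq> board n" "card Q = a"
    and T: "T \<subseteq> unattacked n Q" "card T = b"
    by blast
  then have fin: "finite Q" "finite T"
    by (auto simp: unattacked_def intro: finite_subset[OF _ finite_board[of n]])
  define m :: qmonom where
    "m = (\<Sum>s\<in>Q. Poly_Mapping.single (XV s) 1) + (\<Sum>t\<in>T. Poly_Mapping.single (YV t) 1)"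
  have lookup: "Poly_Mapping.lookup m (XV s) = (if s \<in> Q then 1 else 0)"
    "Poly_Mapping.lookup m (YV s) = (if s \<in> T then 1 else 0)" for s
    using fin by (simp_all add: m_def lookup_add lookup_sum lookup_single when_def)
  have keys: "XV s \<in> Poly_Mapping.keys m \<longleftrightarrow> s \<in> Q" "YV s \<in> Poly_Mapping.keys m \<longleftrightarrow> s \<in> T" for s
    by (simp_all add: in_keys_iff lookup)
  have "Poly_Mapping.keys m \<subseteq> qvars n"
  proof
    fix v assume "v \<in> Poly_Mapping.keys m"
    then show "v \<in> qvars n"
      using Q T by (cases v) (auto simp: keys qvars_def unattacked_def)
  qed
  moreover have "xdeg m = a" "ydeg m = b"
    using Q T by (simp_all add: xdeg_def ydeg_def keys lookup)
  moreover have "Poly_Mapping.lookup m v \<le> 1" for v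
    by (cases v) (simp_all add: lookup)
  then have "peaceful m"
    using T by (auto simp: peaceful_def keys unattacked_def simp del: queen_move.simps)
  ultimately show "\<exists>m\<in>board_monoms n a b. peaceful m"
    by (auto simp: board_monoms_def)
qed

text \<open>
  Subsets of unattacked sets have all smaller cardinalities, so the nonzero components form an
  initial segment. This is what turns the existence of a monomial into a maximum.
\<close>

lemma quot_dim_pos_iff_le_unattacked:
  "quot_dim TYPE('k::field) n a b > 0 \<longleftrightarrow>
     (\<exists>Q. Q \<subseteq> board n \<and> card Q = a \<and> b \<le> card (unattacked n Q))"
proof -
  have fin: "finite (unattacked n Q)" for Q
    by (rule finite_subset[OF _ finite_board[of n]]) (auto simp: unattacked_def)
  have "(\<exists>T. T \<subseteq> unattacked n Q \<and> card T = b) \<longleftrightarrow> b \<le> card (unattacked n Q)" for Q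
    using card_mono[OF fin] obtain_subset_with_card_n by metis
  then show ?thesis
    unfolding quot_dim_pos_iff peaceful_monom_iff by metis
qed

theorem proposition2p1:
  fixes n k :: nat
  assumes "n \<ge> 1" and "1 \<le> k" and "k \<le> n\<^sup>2"
  shows "finite {\<mu>. quot_dim TYPE('k::field) n k \<mu> > 0}
       \<and> {\<mu>. quot_dim TYPE('k) n k \<mu> > 0} \<noteq> {}
       \<and> mu TYPE('k) n k = max_unattacked n k"
proof -
  define A where "A = {card (unattacked n Q) | Q. Q \<subseteq> board n \<and> card Q = k}"
  have "A \<subseteq> (\<lambda>Q. card (unattacked n Q)) ` Pow (board n)"
    by (auto simp: A_def)
  then have fin: "finite A"
    using finite_board by (meson finite_Pow_iff finite_imageI finite_subset)
  have "k \<le> card (board n)"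
    using assms(3) by (simp add: board_def power2_eq_square)
  \<comment> \<open>The board has room for \<open>k\<close> queens, so the maximum is over a nonempty set.\<close>
  then obtain Q where "Q \<subseteq> board n" "card Q = k"
    by (rule obtain_subset_with_card_n)
  then have ne: "A \<noteq> {}"
    by (auto simp: A_def)
  have "quot_dim TYPE('k) n k \<mu> > 0 \<longleftrightarrow> \<mu> \<le> Max A" for \<mu>
    unfolding quot_dim_pos_iff_le_unattacked Max_ge_iff[OF fin ne] by (auto simp: A_def)
  then have segment: "{\<mu>. quot_dim TYPE('k) n k \<mu> > 0} = {..Max A}"
    by blast
  have "Max {..Max A} = Max A"
    by (rule Max_eqI) auto
  then have "mu TYPE('k) n k = max_unattacked n k"
    unfolding mu_def segment max_unattacked_def A_def .
  then show ?thesis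
    unfolding segment by blast
qed

end
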